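(* Let $X$ be a transitive subshift which has exactly $j \ge 3$ minimal subsystems, exactly $i$ of which are infinite ($0\le i\le j$). Then $$\liminf_{n \to \infty} (c_X(n) - (j+i)n) = \infty.$$
   Context: A subshift is a closed, $\sigma$-invariant subset $X\subset\mathcal A^{\mathbb Z}$, where $\mathcal A$ is a finite alphabet, $\mathcal A^{\mathbb Z}$ carries the product topology, and $\sigma(x)_k=x_{k+1}$ is the left shift. A word of length $n$ in $X$ is a block $x_k x_{k+1}\cdots x_{k+n-1}$ occurring in some $x\in X$; $c_X(n)$ is the number of words of length $n$ in $X$. The orbit of $x$ is $\mathcal O(x)=\{\sigma^n(x):n\in\mathbb Z\}$; $X$ is transitive if $X=\overline{\mathcal O(x)}$ for some $x\in X$ (not necessarily recurrent), and minimal if $X=\overline{\mathcal O(x)}$ for every $x\in X$. A minimal subsystem of $X$ is a subshift contained in $X$ that is minimal. *)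

theory Defs
  imports "HOL-Analysis.Analysis"
begin

definition full_shift_topology :: "(int \<Rightarrow> 'a) topology" where
  "full_shift_topology = product_topology (\<lambda>_. discrete_topology UNIV) UNIV"

definition shift :: "(int \<Rightarrow> 'a) \<Rightarrow> (int \<Rightarrow> 'a)" where
  "shift x = (\<lambda>k. x (k + 1))"

definition shift_pow :: "int \<Rightarrow> (int \<Rightarrow> 'a) \<Rightarrow> (int \<Rightarrow> 'a)" where
  "shift_pow n = (if n \<ge> 0 then shift ^^ nat n else inv shift ^^ nat (- n))"

lemma inv_shift: "inv shift = (\<lambda>x k. x (k - 1))"
  by (rule inv_unique_comp) (auto simp: shift_def fun_eq_iff)

lemma shift_pow_apply: "shift_pow n x k = x (k + n)"
proof -
  have pos: "(shift ^^ m) x k = x (k + int m)" for m k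
    by (induction m arbitrary: k) (auto simp: shift_def algebra_simps)
  have neg: "(inv shift ^^ m) x k = x (k - int m)" for m k
    by (induction m arbitrary: k) (auto simp: inv_shift algebra_simps)
  show ?thesis
    by (simp add: shift_pow_def pos neg)
qed

text \<open>For a two-sided shift, invariance is read as \<open>\<sigma>(X) = X\<close>. The empty set is
  a subshift in this sense.\<close>

definition subshift :: "(int \<Rightarrow> 'a) set \<Rightarrow> bool" where
  "subshift X \<longleftrightarrow> closedin full_shift_topology X \<and> shift ` X = X"

definition orbit :: "(int \<Rightarrow> 'a) \<Rightarrow> (int \<Rightarrow> 'a) set" where
  "orbit x = {shift_pow n x | n. True}"

definition transitive_subshift :: "(int \<Rightarrow> 'a) set \<Rightarrow> bool" where
  "transitive_subshift X \<longleftrightarrow>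
     subshift X \<and> (\<exists>x\<in>X. X = full_shift_topology closure_of (orbit x))"

text \<open>Nonemptiness has to be required: the empty subshift satisfies the condition on
  orbit closures vacuously, but is not counted as a minimal system.\<close>

definition minimal_subshift :: "(int \<Rightarrow> 'a) set \<Rightarrow> bool" where
  "minimal_subshift X \<longleftrightarrow>
     subshift X \<and> X \<noteq> {} \<and> (\<forall>x\<in>X. X = full_shift_topology closure_of (orbit x))"

definition minimal_subsystems :: "(int \<Rightarrow> 'a) set \<Rightarrow> (int \<Rightarrow> 'a) set set" where
  "minimal_subsystems X = {M. M \<subseteq> X \<and> minimal_subshift M}"

definition words :: "(int \<Rightarrow> 'a) set \<Rightarrow> nat \<Rightarrow> 'a list set" where
  "words X n = {map (\<lambda>m. x (k + int m)) [0..<n] | x k. x \<in> X}"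

definition complexity :: "(int \<Rightarrow> 'a) set \<Rightarrow> nat \<Rightarrow> nat" where
  "complexity X n = card (words X n)"

end

theory Submission
  imports Defs
begin

text \<open>Let \<open>X\<close> be the orbit closure of \<open>x\<close>. Each minimal subsystem occurs in \<open>x\<close> arbitrarily far to
  the right or arbitrarily far to the left, so among three of them two do so on the same side; by
  reflection let it be the right. Then to the right of any occurrence in \<open>x\<close> of a long word of a
  minimal subsystem \<open>M\<close> the sequence leaves \<open>M\<close> again. This yields one additional word of length
  \<open>n + 1\<close> for every \<open>M\<close>, and infinite \<open>M\<close> gain another word inside \<open>M\<close>, as in the
  Morse--Hedlund theorem. Hence \<open>c(n) - (j + i) n\<close> is eventually nondecreasing. It increases
  whenever a right special word of length \<open>n\<close> lies outside all minimal subsystems, and this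
  happens infinitely often: otherwise \<open>x\<close> would be eventually periodic to the right.\<close>

section \<open>Factors of a bi-infinite sequence\<close>

definition factor :: "(int \<Rightarrow> 'a) \<Rightarrow> int \<Rightarrow> nat \<Rightarrow> 'a list" where
  "factor x p n = map (\<lambda>m. x (p + int m)) [0..<n]"

definition factors :: "(int \<Rightarrow> 'a) \<Rightarrow> nat \<Rightarrow> 'a list set" where
  "factors x n = range (\<lambda>p. factor x p n)"

lemma length_factor [simp]: "length (factor x p n) = n"
  by (simp add: factor_def)

lemma factor_eq_iff: "factor x p n = factor y q n \<longleftrightarrow> (\<forall>m<n. x (p + int m) = y (q + int m))"
  by (auto simp: factor_def)

lemma factor_Suc: "factor x p (Suc n) = factor x p n @ [x (p + int n)]"
  by (simp add: factor_def)

lemma butlast_factor: "butlast (factor x p (Suc n)) = factor x p n"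
  by (simp add: factor_Suc)

lemma factor_append: "factor x p (m + n) = factor x p m @ factor x (p + int m) n"
  by (induction n) (auto simp: factor_Suc factor_def add.assoc)

lemma factor_Suc_Cons: "factor x p (Suc n) = x p # factor x (p + 1) n"
  using factor_append[of x p 1 n] by (simp add: factor_def)

lemma factor_split:
  assumes "p \<le> q" "q + int m \<le> p + int n"
  shows "\<exists>u v. factor x p n = u @ factor x q m @ v"
proof -
  define k where "k = nat (q - p)"
  define l where "l = nat (p + int n - (q + int m))"
  have q: "q = p + int k" using assms by (simp add: k_def)
  have "n = k + (m + l)" using assms by (simp add: k_def l_def)
  then show ?thesis by (metis factor_append q)
qed

lemma butlast_factors: "butlast ` factors x (Suc n) = factors x n"
  by (auto simp: factors_def image_image butlast_factor)

lemma finite_lists_of_length: "finite {w :: 'a::finite list. P w \<and> length w = n}"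
  by (rule finite_subset[OF _ finite_lists_length_eq[OF finite, of UNIV n]]) auto

lemma finite_factors: "finite (factors (x :: int \<Rightarrow> 'a::finite) n)"
  by (rule finite_subset[OF _ finite_lists_of_length[of "\<lambda>_. True" n]]) (auto simp: factors_def)

lemma factor_reflect: "factor (\<lambda>k. x (- k)) p n = rev (factor x (1 - p - int n) n)"
  by (rule nth_equalityI)
     (auto simp: factor_def rev_nth of_nat_diff algebra_simps intro!: arg_cong[of _ _ x])

lemma factors_reflect: "factors (\<lambda>k. x (- k)) n = rev ` factors x n"
proof -
  have "bij (\<lambda>p. 1 - p - int n)"
    by (rule o_bij[of "\<lambda>p. 1 - p - int n"]) auto
  then have "range (\<lambda>p. rev (factor x (1 - p - int n) n)) = range (\<lambda>p. rev (factor x p n))"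
    using image_image[of "\<lambda>p. rev (factor x p n)" "\<lambda>p. 1 - p - int n" UNIV] bij_is_surj by metis
  then show ?thesis
    by (simp add: factors_def factor_reflect image_image)
qed

section \<open>Auxiliary facts on counting and divergence\<close>

lemma card_Suc_le_of_not_inj:
  assumes "finite A" "f ` A = B" "\<not> inj_on f A"
  shows "card B + 1 \<le> card A"
  using assms card_image_le[of A f] eq_card_imp_inj_on[of A f] by fastforce

text \<open>Each late jump gains at least 1 and monotonicity beyond \<open>N\<close> keeps every
  gain, so arbitrarily many gains accumulate.\<close>

lemma filterlim_at_top_frequent_jumps:
  fixes d :: "nat \<Rightarrow> real"
  assumes mono: "\<And>n. n \<ge> N \<Longrightarrow> d n \<le> d (Suc n)"
    and jump: "\<And>m. \<exists>n\<ge>m. d n + 1 \<le> d (Suc n)"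
  shows "filterlim d at_top sequentially"
proof -
  have le: "d m \<le> d n" if "N \<le> m" "m \<le> n" for m n
    using that(2,1)
  proof (induction rule: dec_induct)
    case (step n)
    then show ?case using mono[of n] by simp
  qed simp
  have ex: "\<exists>n\<ge>N. d N + real k \<le> d n" for k
  proof (induction k)
    case 0
    show ?case by auto
  next
    case (Suc k)
    then obtain n where n: "n \<ge> N" "d N + real k \<le> d n" by blast
    obtain m where m: "m \<ge> n" "d m + 1 \<le> d (Suc m)" using jump by blast
    have "d n \<le> d m" using le n m by simp
    then show ?case using n m by (intro exI[of _ "Suc m"]) auto
  qed
  show ?thesis
    unfolding filterlim_at_top eventually_sequentially
  proof
    fix Z :: real
    obtain k :: nat where "Z - d N \<le> real k" using real_arch_simple by blast
    then obtain n where "n \<ge> N" "Z \<le> d n" using ex[of k] by force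
    then show "\<exists>n. \<forall>m\<ge>n. Z \<le> d m" using le by (meson order_trans)
  qed
qed

section \<open>Disjoint languages occurring in a sequence\<close>

text \<open>Combinatorial setting of the count: \<open>I\<close> stands for the minimal subsystems,
  \<open>J\<close> for the infinite ones, \<open>L i\<close> for their languages. Disjointness of
  subsystems enters only as \<open>separated\<close>, infinitude only as
  \<open>unbounded\<close>.\<close>

locale language_family =
  fixes x :: "int \<Rightarrow> 'a::finite" and I J :: "'i set" and L :: "'i \<Rightarrow> 'a list set"
  assumes finite_I: "finite I" and J_subset: "J \<subseteq> I"
    and factorial: "\<And>i u v w. i \<in> I \<Longrightarrow> u @ v @ w \<in> L i \<Longrightarrow> v \<in> L i"
    and extend_left: "\<And>i w. i \<in> I \<Longrightarrow> w \<in> L i \<Longrightarrow> \<exists>a. a # w \<in> L i"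
    and extend_right: "\<And>i w. i \<in> I \<Longrightarrow> w \<in> L i \<Longrightarrow> \<exists>a. w @ [a] \<in> L i"
    and nonempty: "\<And>i. i \<in> I \<Longrightarrow> L i \<noteq> {}"
    and occurs: "\<And>i w. i \<in> I \<Longrightarrow> w \<in> L i \<Longrightarrow> \<exists>p. factor x p (length w) = w"
    and separated: "\<And>i k. i \<in> I \<Longrightarrow> k \<in> I \<Longrightarrow> i \<noteq> k \<Longrightarrow> \<exists>n. \<forall>w \<in> L i \<inter> L k. length w < n"
    and unbounded: "\<And>i K. i \<in> J \<Longrightarrow> \<exists>n. K \<le> card {w \<in> L i. length w = n}"
begin

abbreviation level :: "'i \<Rightarrow> nat \<Rightarrow> 'a list set" where
  "level i n \<equiv> {w \<in> L i. length w = n}"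

lemma finite_level: "finite (level i n)"
  by (rule finite_lists_of_length)

text \<open>Reversal exchanges the two extension properties and preserves the others. This makes
  left recurrence a case of right recurrence.\<close>

lemma reflect: "language_family (\<lambda>k. x (- k)) I J (\<lambda>i. rev ` L i)"
proof
  have mem: "w \<in> rev ` L i \<longleftrightarrow> rev w \<in> L i" for w i by force
  show "finite I" "J \<subseteq> I" by (rule finite_I J_subset)+
  show "v \<in> rev ` L i" if "i \<in> I" "u @ v @ w \<in> rev ` L i" for i u v w
    using factorial[of i "rev w" "rev v" "rev u"] that by (simp add: mem)
  show "\<exists>a. a # w \<in> rev ` L i" if "i \<in> I" "w \<in> rev ` L i" for i w
    using extend_right[of i "rev w"] that by (simp add: mem)
  show "\<exists>a. w @ [a] \<in> rev ` L i" if "i \<in> I" "w \<in> rev ` L i" for i w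
    using extend_left[of i "rev w"] that by (simp add: mem)
  show "rev ` L i \<noteq> {}" if "i \<in> I" for i
    using nonempty that by simp
  show "\<exists>p. factor (\<lambda>k. x (- k)) p (length w) = w" if w: "i \<in> I" "w \<in> rev ` L i" for i w
  proof -
    obtain p where "factor x p (length w) = rev w"
      using occurs[of i "rev w"] w unfolding mem length_rev by blast
    then have "factor (\<lambda>k. x (- k)) (1 - p - int (length w)) (length w) = w"
      by (simp add: factor_reflect)
    then show ?thesis ..
  qed
  show "\<exists>n. \<forall>w \<in> rev ` L i \<inter> rev ` L k. length w < n" if ik: "i \<in> I" "k \<in> I" "i \<noteq> k" for i k
  proof -
    obtain n where "\<forall>w \<in> L i \<inter> L k. length w < n" using separated ik by blast
    then have "\<forall>w \<in> rev ` L i \<inter> rev ` L k. length w < n" by (auto simp: mem)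
    then show ?thesis ..
  qed
  show "\<exists>n. K \<le> card {w \<in> rev ` L i. length w = n}" if "i \<in> J" for i K
  proof -
    have "{w \<in> rev ` L i. length w = n} = rev ` level i n" for n by auto
    then have "card {w \<in> rev ` L i. length w = n} = card (level i n)" for n
      by (simp add: card_image)
    then show ?thesis using unbounded[OF that] by simp
  qed
qed

section \<open>Growth of the levels of one language\<close>

lemma factor_in_sub:
  assumes "i \<in> I" "factor x p n \<in> L i" "p \<le> q" "q + int m \<le> p + int n"
  shows "factor x q m \<in> L i"
  using factorial[OF assms(1)] factor_split[OF assms(3,4), of x] assms(2) by metis

text \<open>Factoriality gives one inclusion and right extendability the other. Levels can thus be
  compared through the fibres of \<open>butlast\<close>.\<close>

lemma butlast_level:
  assumes "i \<in> I"
  shows "butlast ` level i (Suc n) = level i n"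
proof
  show "butlast ` level i (Suc n) \<subseteq> level i n"
  proof
    fix v assume "v \<in> butlast ` level i (Suc n)"
    then obtain w where w: "w \<in> L i" "length w = Suc n" "v = butlast w" by blast
    then have "w = [] @ v @ [last w]"
      by (metis append_Nil append_butlast_last_id list.size(3) nat.distinct(1))
    then have "v \<in> L i" using factorial[OF assms] w(1) by metis
    then show "v \<in> level i n" using w by simp
  qed
  show "level i n \<subseteq> butlast ` level i (Suc n)"
  proof
    fix v assume v: "v \<in> level i n"
    then obtain a where "v @ [a] \<in> L i" using extend_right[OF assms] by blast
    then have "v @ [a] \<in> level i (Suc n)" using v by simp
    then show "v \<in> butlast ` level i (Suc n)" by (metis butlast_snoc image_eqI)
  qed
qed

lemma card_level_mono:
  assumes "i \<in> I"
  shows "card (level i n) \<le> card (level i (Suc n))"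
  using card_image_le[OF finite_level[of i "Suc n"], of butlast] butlast_level[OF assms] by simp

lemma level_nonempty:
  assumes "i \<in> I"
  obtains w where "w \<in> L i" "length w = n"
proof -
  have "\<exists>w. w \<in> level i n"
  proof (induction n)
    case 0
    obtain w where "w \<in> L i" using nonempty[OF assms] by blast
    then have "[] \<in> L i" using factorial[OF assms, of "[]" "[]" w] by simp
    then show ?case by auto
  next
    case (Suc n)
    then show ?case using butlast_level[OF assms, of n] by blast
  qed
  then show thesis using that by blast
qed

text \<open>A suffix of a right special word is right special; hence if no word of some length is
  right special then the number of words is bounded.\<close>

lemma card_level_strict_mono:
  assumes "i \<in> J"
  shows "card (level i n) + 1 \<le> card (level i (Suc n))"
proof (rule ccontr)
  assume less: "\<not> ?thesis"
  have iI: "i \<in> I" using assms J_subset by blast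
  have inj: "inj_on butlast (level i (Suc n))"
    using less card_Suc_le_of_not_inj[OF finite_level butlast_level[OF iI]] by blast
  have le: "card (level i m) \<le> card (level i n)" if "n \<le> m" for m
    using that
  proof (induction rule: dec_induct)
    case (step m)
    have "inj_on butlast (level i (Suc m))"
    proof (rule inj_onI)
      fix v w assume v: "v \<in> level i (Suc m)" and w: "w \<in> level i (Suc m)"
        and eq: "butlast v = butlast w"
      \<comment> \<open>The suffix of length \<open>n + 1\<close> of a word of length
        \<open>m + 1\<close>. Two words with equal \<open>butlast\<close> have suffixes with equal
        \<open>butlast\<close>, so injectivity at level \<open>n + 1\<close> forces the same last
        letter.\<close>
      have mem: "drop (m - n) u \<in> level i (Suc n)" if "u \<in> level i (Suc m)" for u
        using that factorial[OF iI, of "take (m - n) u" "drop (m - n) u" "[]"] step(1) by simp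
      have "butlast (drop (m - n) v) = butlast (drop (m - n) w)"
        using eq by (metis drop_butlast)
      then have d: "drop (m - n) v = drop (m - n) w"
        using inj mem[OF v] mem[OF w] by (meson inj_onD)
      have "last v = last (drop (m - n) v)" "last w = last (drop (m - n) w)"
        using v w by (simp_all add: last_drop)
      then have "last v = last w" using d by simp
      moreover have "v \<noteq> []" "w \<noteq> []" using v w by auto
      ultimately show "v = w" using eq by (metis append_butlast_last_id)
    qed
    then have "card (level i (Suc m)) = card (level i m)"
      using card_image[of butlast "level i (Suc m)"] butlast_level[OF iI, of m] by simp
    then show ?case using step by simp
  qed simp
  have mono: "card (level i m) \<le> card (level i k)" if "m \<le> k" for m k
    using lift_Suc_mono_le[of "\<lambda>n. card (level i n)", OF card_level_mono[OF iI] that] .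
  obtain m where "card (level i n) + 1 \<le> card (level i m)" using unbounded[OF assms] by blast
  then show False using le[of m] mono[of m n] by (cases "n \<le> m") auto
qed

section \<open>Separation threshold and right special words outside the languages\<close>

definition separates :: "nat \<Rightarrow> bool" where
  "separates N \<longleftrightarrow> (\<forall>i\<in>I. \<forall>k\<in>I. \<forall>w\<in>L i \<inter> L k. N \<le> length w \<longrightarrow> i = k)"

lemma separatesD:
  "separates N \<Longrightarrow> i \<in> I \<Longrightarrow> k \<in> I \<Longrightarrow> w \<in> L i \<Longrightarrow> w \<in> L k \<Longrightarrow> N \<le> length w \<Longrightarrow> i = k"
  by (auto simp: separates_def)

text \<open>Such a word \<open>v\<close> branches in \<open>x\<close> without belonging to any of
  the languages, so its second extension comes on top of the words gained over the
  languages.\<close>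

definition outer_right_special :: "nat \<Rightarrow> bool" where
  "outer_right_special n \<longleftrightarrow> (\<exists>v c d. c \<noteq> d \<and> v @ [c] \<in> factors x (Suc n) \<and>
     v @ [d] \<in> factors x (Suc n) \<and> v \<notin> (\<Union>i\<in>I. L i))"

text \<open>There are finitely many pairs of indices, so the maximum of their individual bounds
  serves all of them.\<close>

lemma ex_separates: "\<exists>N. separates N"
proof -
  have "\<forall>z \<in> I \<times> I. \<exists>n. fst z \<noteq> snd z \<longrightarrow> (\<forall>w \<in> L (fst z) \<inter> L (snd z). length w < n)"
    using separated by auto
  then obtain f where f: "\<And>z. z \<in> I \<times> I \<Longrightarrow> fst z \<noteq> snd z \<Longrightarrow>
      \<forall>w \<in> L (fst z) \<inter> L (snd z). length w < f z"
    by metis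
  have "i = k" if h: "i \<in> I" "k \<in> I" "w \<in> L i \<inter> L k" "Max (f ` (I \<times> I)) \<le> length w" for i k w
  proof (rule ccontr)
    assume "i \<noteq> k"
    then have "length w < f (i, k)" using f[of "(i, k)"] h by simp
    also have "\<dots> \<le> Max (f ` (I \<times> I))" using finite_I h by (intro Max_ge) auto
    finally show False using h by simp
  qed
  then have "separates (Max (f ` (I \<times> I)))" unfolding separates_def by blast
  then show ?thesis ..
qed

end

section \<open>Sequences that visit two of the languages arbitrarily far to the right\<close>

locale right_recurrent_family = language_family +
  fixes a b :: 'b
  assumes a: "a \<in> I" and b: "b \<in> I" and a_neq_b: "a \<noteq> b"
    and recur_right: "\<And>c w P. c \<in> {a, b} \<Longrightarrow> w \<in> L c \<Longrightarrow> \<exists>p\<ge>P. factor x p (length w) = w"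
begin

text \<open>One of \<open>a\<close>, \<open>b\<close> differs from \<open>i\<close>; a word of
  length \<open>n\<close> of its language occurs to the right of \<open>p\<close> and is not in
  \<open>L i\<close>. A window sliding there from \<open>p\<close> must leave \<open>L i\<close> at
  some step.\<close>

lemma exit_word:
  assumes i: "i \<in> I"
    and N: "separates N"
    and n: "N \<le> n"
    and p: "factor x p n \<in> L i"
  obtains r where "p \<le> r" "factor x r n \<in> L i" "factor x (r + 1) n \<notin> L i"
proof -
  obtain c where c: "c \<in> {a, b}" "c \<noteq> i" using a_neq_b by blast
  have cI: "c \<in> I" using c a b by blast
  obtain w where w: "w \<in> L c" "length w = n" using level_nonempty[OF cI] .
  obtain q where q: "q \<ge> p" "factor x q n = w" using recur_right[OF c(1) w(1)] w(2) by blast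
  have out: "factor x q n \<notin> L i" using separatesD[OF N i cI] w c q n by auto
  have "\<exists>r\<ge>p. factor x r n \<in> L i \<and> factor x (r + 1) n \<notin> L i"
  proof (rule ccontr)
    assume "\<not> ?thesis"
    then have stay: "factor x (r + 1) n \<in> L i" if "p \<le> r" "factor x r n \<in> L i" for r
      using that by blast
    have "factor x q n \<in> L i" using q(1)
    proof (induction q rule: int_ge_induct)
      case base
      show ?case by (rule p)
    next
      case (step q)
      then show ?case using stay by blast
    qed
    then show False using out by contradiction
  qed
  then show thesis using that by blast
qed

text \<open>Under periodicity a long enough word of \<open>L a\<close> would contain every block of
  length \<open>n\<close> occurring further right, in particular a word of \<open>L b\<close>,
  against separation.\<close>

lemma not_eventually_periodic:
  assumes d: "d > 0" and per: "\<And>k. k \<ge> p \<Longrightarrow> x (k + d) = x k"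
  shows False
proof -
  obtain n where n: "\<forall>w \<in> L a \<inter> L b. length w < n" using separated[OF a b a_neq_b] by blast
  \<comment> \<open>The extra \<open>d\<close> letters leave room for a block of length
    \<open>n\<close> starting at any residue modulo \<open>d\<close>.\<close>
  obtain w where w: "w \<in> L a" "length w = n + nat d" using level_nonempty[OF a] .
  obtain v where v: "v \<in> L b" "length v = n" using level_nonempty[OF b] .
  obtain r where r: "r \<ge> p" "factor x r (n + nat d) = w" using recur_right[of a w p] w by auto
  obtain s where s: "s \<ge> r" "factor x s n = v" using recur_right[of b v r] v by auto
  have per': "x (k + int m * d) = x k" if "k \<ge> p" for k m
  proof (induction m)
    case (Suc m)
    have "x (k + int m * d + d) = x (k + int m * d)"
    proof (rule per)
      have "0 \<le> int m * d" using d by simp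
      then show "p \<le> k + int m * d" using that by linarith
    qed
    then show ?case using Suc by (simp add: algebra_simps)
  qed simp
  \<comment> \<open>The position congruent to \<open>s\<close> modulo \<open>d\<close> within the
    first period after \<open>r\<close>; \<open>m\<close> periods lead from \<open>t\<close> to
    \<open>s\<close>.\<close>
  define t where "t = r + (s - r) mod d"
  define m where "m = nat ((s - r) div d)"
  have t: "r \<le> t" "t < r + d" using d by (auto simp: t_def)
  have "int m = (s - r) div d" using d s(1) by (simp add: m_def pos_imp_zdiv_nonneg_iff)
  then have st: "s = t + int m * d" by (simp add: t_def)
  have "factor x t n = factor x s n"
    unfolding factor_eq_iff
  proof (intro allI impI)
    fix l assume "l < n"
    have "x (t + int l + int m * d) = x (t + int l)" using t r by (intro per') auto
    then show "x (t + int l) = x (s + int l)" by (simp add: st algebra_simps)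
  qed
  moreover have "factor x t n \<in> L a"
    using factor_in_sub[OF a, of r "n + nat d" t n] w r t by simp
  ultimately have "v \<in> L a \<inter> L b" using s v by simp
  then show False using n v by auto
qed

text \<open>Otherwise a long word outside all the languages would determine the whole sequence to its
  right. Such words occur arbitrarily far to the right, because the sequence keeps moving between
  the languages of \<open>a\<close> and \<open>b\<close>, so one of them would occur twice and make the sequence
  eventually periodic.\<close>

lemma frequently_outer_right_special: "\<exists>n\<ge>m. outer_right_special n"
proof (rule ccontr)
  assume none: "\<not> ?thesis"
  obtain N where N: "separates N"
    using ex_separates by blast
  \<comment> \<open>At least \<open>N + 1\<close>, so that the overlap of two consecutive windows,
    of length \<open>n - 1\<close>, still identifies its language.\<close>
  define n where "n = max m (Suc N)"
  define S where "S = {p. factor x p n \<notin> (\<Union>i\<in>I. L i)}"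
  have S_right: "\<exists>p\<ge>P. p \<in> S" for P
  proof -
    obtain w where w: "w \<in> L a" "length w = n" using level_nonempty[OF a] .
    obtain q where q: "q \<ge> P" "factor x q n = w" using recur_right[of a w P] w by auto
    obtain r where r: "q \<le> r" "factor x r n \<in> L a" "factor x (r + 1) n \<notin> L a"
    proof (rule exit_word[OF a N, of n q])
      show "N \<le> n" by (simp add: n_def)
      show "factor x q n \<in> L a" using q w by simp
    qed
    \<comment> \<open>The window at \<open>r + 1\<close> shares \<open>n - 1\<close> letters with
      the one at \<open>r\<close> in \<open>L a\<close>. Membership in some \<open>L i\<close> would
      force \<open>i = a\<close>, which the exit excludes.\<close>
    have "r + 1 \<in> S"
      unfolding S_def
    proof (rule CollectI, rule notI)
      assume "factor x (r + 1) n \<in> (\<Union>i\<in>I. L i)"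
      then obtain i where i: "i \<in> I" "factor x (r + 1) n \<in> L i" by blast
      have "factor x (r + 1) (n - 1) \<in> L i"
        using factor_in_sub[OF i, of "r + 1" "n - 1"] by simp
      moreover have "factor x (r + 1) (n - 1) \<in> L a"
        using factor_in_sub[OF a r(2), of "r + 1" "n - 1"] by (simp add: n_def)
      ultimately have "i = a" using separatesD[OF N i(1) a] by (simp add: n_def)
      then show False using i r by simp
    qed
    then show ?thesis using q r by (intro exI[of _ "r + 1"]) auto
  qed
  have "infinite S"
  proof
    assume fin: "finite S"
    obtain p where "p \<ge> Max S + 1" "p \<in> S" using S_right by blast
    then show False using Max_ge[OF fin, of p] by simp
  qed
  moreover have "finite ((\<lambda>p. factor x p n) ` S)"
    by (rule finite_subset[OF _ finite_factors[of x n]]) (auto simp: factors_def)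
  ultimately have "\<not> inj_on (\<lambda>p. factor x p n) S" using finite_imageD by blast
  then obtain p q where pq: "p \<in> S" "q \<in> S" "p < q" "factor x p n = factor x q n"
    unfolding inj_on_def by (metis linorder_neqE)
  have same: "factor x p (n + l) = factor x q (n + l)" for l
  proof (induction l)
    case 0
    show ?case using pq by simp
  next
    case (Suc l)
    let ?v = "factor x p (n + l)"
    \<comment> \<open>By factoriality a word with a prefix outside all the languages is itself
      outside; not being right special, it has only one continuation.\<close>
    have "?v \<notin> (\<Union>i\<in>I. L i)"
    proof
      assume "?v \<in> (\<Union>i\<in>I. L i)"
      then obtain i where i: "i \<in> I" "?v \<in> L i" by blast
      then have "factor x p n \<in> L i" using factor_in_sub[OF i, of p n] by simp
      then show False using pq(1) i(1) by (auto simp: S_def)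
    qed
    moreover have "?v @ [x (p + int (n + l))] \<in> factors x (Suc (n + l))"
      unfolding factors_def factor_Suc by (rule range_eqI[of _ _ p]) simp
    moreover have "?v @ [x (q + int (n + l))] \<in> factors x (Suc (n + l))"
      unfolding factors_def factor_Suc by (rule range_eqI[of _ _ q]) (simp add: Suc)
    moreover have "n + l \<ge> m" by (simp add: n_def)
    ultimately have "x (p + int (n + l)) = x (q + int (n + l))"
      using none unfolding outer_right_special_def by blast
    then show ?case using Suc by (simp add: factor_Suc)
  qed
  show False
  proof (rule not_eventually_periodic)
    show "q - p > 0" using pq by simp
    fix k assume k: "k \<ge> p"
    have "factor x p (n + Suc (nat (k - p))) = factor x q (n + Suc (nat (k - p)))" by (rule same)
    moreover have "nat (k - p) < n + Suc (nat (k - p))" by simp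
    ultimately have "x (p + int (nat (k - p))) = x (q + int (nat (k - p)))"
      unfolding factor_eq_iff by blast
    then show "x (k + (q - p)) = x k" using k by (simp add: algebra_simps)
  qed
qed

text \<open>Words of length \<open>n + 1\<close> are counted according to their prefix of length \<open>n\<close>. Those with
  prefix in \<open>L i\<close> include the words of \<open>L i\<close> and at least one word leaving \<open>L i\<close>.\<close>

lemma card_factors_step:
  assumes N: "separates N"
    and n: "N \<le> n"
  shows "card (factors x n) + (card I + card J) + of_bool (outer_right_special n) \<le> card (factors x (Suc n))"
proof -
  define B where "B i = {v \<in> factors x (Suc n). butlast v \<in> L i}" for i
  define C where "C = {v \<in> factors x (Suc n). butlast v \<notin> (\<Union>i\<in>I. L i)}"
  have fin: "finite (factors x k)" for k by (rule finite_factors)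
  have len: "length v = k" if "v \<in> factors x k" for v k using that by (auto simp: factors_def)
  have sub: "level i k \<subseteq> factors x k" if "i \<in> I" for i k
    using occurs[OF that] by (auto simp: factors_def) (metis rangeI)
  have B: "card (level i n) + 1 + of_bool (i \<in> J) \<le> card (B i)" if i: "i \<in> I" for i
  proof -
    obtain w where w: "w \<in> L i" "length w = n" using level_nonempty[OF i] .
    obtain p where p: "factor x p n \<in> L i" using occurs[OF i w(1)] w by metis
    obtain r where r: "factor x r n \<in> L i" "factor x (r + 1) n \<notin> L i"
      using exit_word[OF i N n p] .
    \<comment> \<open>The window of length \<open>n + 1\<close> across the exit: its prefix lies in
      \<open>L i\<close> but its suffix does not, so it is a member of \<open>B i\<close> outside
      \<open>L i\<close>.\<close>
    define e where "e = factor x r (Suc n)"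
    have e: "e \<notin> L i" using factor_in_sub[OF i, of r "Suc n" "r + 1" n] r by (auto simp: e_def)
    have "insert e (level i (Suc n)) \<subseteq> B i"
    proof
      fix v assume "v \<in> insert e (level i (Suc n))"
      then consider "v = e" | "v \<in> level i (Suc n)" by blast
      then show "v \<in> B i"
      proof cases
        case 1
        then show ?thesis using r by (auto simp: B_def e_def butlast_factor factors_def)
      next
        case 2
        then show ?thesis using sub[OF i] butlast_level[OF i, of n] unfolding B_def by blast
      qed
    qed
    moreover have "finite (B i)" using fin by (simp add: B_def)
    ultimately have "card (insert e (level i (Suc n))) \<le> card (B i)" by (rule card_mono[rotated])
    moreover have "card (insert e (level i (Suc n))) = card (level i (Suc n)) + 1"
      using e finite_level by simp
    moreover have "card (level i n) + of_bool (i \<in> J) \<le> card (level i (Suc n))"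
      using card_level_mono[OF i, of n] card_level_strict_mono[of i n] by auto
    ultimately show ?thesis by simp
  qed
  have C_image: "butlast ` C = factors x n - (\<Union>i\<in>I. L i)"
    unfolding butlast_factors[of x n, symmetric] C_def by blast
  have finC: "finite C" using fin by (simp add: C_def)
  have C: "card (factors x n - (\<Union>i\<in>I. L i)) + of_bool (outer_right_special n) \<le> card C"
  proof (cases "outer_right_special n")
    case True
    then obtain v c d where "c \<noteq> d" "v @ [c] \<in> C" "v @ [d] \<in> C"
      unfolding outer_right_special_def C_def by auto
    then have "\<not> inj_on butlast C"
      by (metis butlast_snoc inj_onD last_snoc)
    then show ?thesis using card_Suc_le_of_not_inj[OF finC C_image] True by simp
  next
    case False
    then show ?thesis using card_image_le[OF finC, of butlast] C_image by simp
  qed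
  have disj: "disjoint_family_on B I"
    unfolding disjoint_family_on_def
  proof (intro ballI impI equals0I)
    fix i k v assume h: "i \<in> I" "k \<in> I" "i \<noteq> k" "v \<in> B i \<inter> B k"
    then have "length (butlast v) = n" using len by (auto simp: B_def)
    then show False using separatesD[OF N h(1,2), of "butlast v"] h n by (auto simp: B_def)
  qed
  have disj': "disjoint_family_on (\<lambda>i. level i n) I"
    unfolding disjoint_family_on_def using separatesD[OF N] n by blast
  have "card (factors x (Suc n)) = card ((\<Union>i\<in>I. B i) \<union> C)"
    by (rule arg_cong[of _ _ card]) (auto simp: B_def C_def)
  also have "\<dots> = card (\<Union>i\<in>I. B i) + card C"
    using finC finite_I fin by (intro card_Un_disjoint) (auto simp: B_def C_def)
  also have "card (\<Union>i\<in>I. B i) = (\<Sum>i\<in>I. card (B i))"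
    using disj finite_I fin by (intro card_UN_disjoint) (auto simp: B_def disjoint_family_on_def)
  finally have decomp: "card (factors x (Suc n)) = (\<Sum>i\<in>I. card (B i)) + card C" .
  have card_J: "(\<Sum>i\<in>I. of_bool (i \<in> J)) = card J"
    using finite_I J_subset by (simp add: Int_absorb1)
  \<comment> \<open>The levels are disjoint as well, so the bounds on the \<open>B i\<close> add up:
    one exit word for each index, and one further word for each index in \<open>J\<close>.\<close>
  have "card (\<Union>i\<in>I. level i n) + card I + card J =
      (\<Sum>i\<in>I. card (level i n)) + card I + (\<Sum>i\<in>I. of_bool (i \<in> J))"
    unfolding card_J using disj' finite_I finite_level
    by (subst card_UN_disjoint) (auto simp: disjoint_family_on_def)
  also have "\<dots> = (\<Sum>i\<in>I. card (level i n) + 1 + of_bool (i \<in> J))"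
    unfolding sum.distrib by simp
  also have "\<dots> \<le> (\<Sum>i\<in>I. card (B i))"
    using B by (intro sum_mono) auto
  finally have step: "card (\<Union>i\<in>I. level i n) + card I + card J + card C \<le> card (factors x (Suc n))"
    using decomp by simp
  have "factors x n = (\<Union>i\<in>I. level i n) \<union> (factors x n - (\<Union>i\<in>I. L i))"
    using sub len by blast
  then have "card (factors x n) \<le> card (\<Union>i\<in>I. level i n) + card (factors x n - (\<Union>i\<in>I. L i))"
    using card_Un_le[of "\<Union>i\<in>I. level i n" "factors x n - (\<Union>i\<in>I. L i)"] by simp
  then show ?thesis using step C by linarith
qed

section \<open>Divergence of the corrected factor count\<close>

theorem complexity_growth_right:
  "filterlim (\<lambda>n. real (card (factors x n)) - real (card I + card J) * real n) at_top sequentially"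
proof -
  obtain N where N: "separates N"
    using ex_separates by blast
  show ?thesis
  proof (rule filterlim_at_top_frequent_jumps)
    fix n assume "N \<le> n"
    then have "card (factors x n) + (card I + card J) \<le> card (factors x (Suc n))"
      using card_factors_step[OF N, of n] by simp
    then have "real (card (factors x n) + (card I + card J)) \<le> real (card (factors x (Suc n)))"
      by (rule of_nat_mono)
    then show "real (card (factors x n)) - real (card I + card J) * real n
      \<le> real (card (factors x (Suc n))) - real (card I + card J) * real (Suc n)"
      by (simp add: algebra_simps)
  next
    fix m
    obtain n where n: "n \<ge> max m N" and special: "outer_right_special n"
      using frequently_outer_right_special by blast
    have "card (factors x n) + (card I + card J) + 1 \<le> card (factors x (Suc n))"
      using card_factors_step[OF N, of n] n special by simp
    then have "real (card (factors x n) + (card I + card J) + 1) \<le> real (card (factors x (Suc n)))"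
      by (rule of_nat_mono)
    then have "real (card (factors x n)) - real (card I + card J) * real n + 1
      \<le> real (card (factors x (Suc n))) - real (card I + card J) * real (Suc n)"
      by (simp add: algebra_simps)
    then show "\<exists>n\<ge>m. real (card (factors x n)) - real (card I + card J) * real n + 1
      \<le> real (card (factors x (Suc n))) - real (card I + card J) * real (Suc n)"
      using n by auto
  qed
qed

end

theorem (in language_family) complexity_growth:
  assumes ab: "a \<in> I" "b \<in> I" "a \<noteq> b"
    and recur: "(\<forall>c\<in>{a, b}. \<forall>w\<in>L c. \<forall>P. \<exists>p\<ge>P. factor x p (length w) = w) \<or>
      (\<forall>c\<in>{a, b}. \<forall>w\<in>L c. \<forall>P. \<exists>p\<le>P. factor x p (length w) = w)"
  shows "filterlim (\<lambda>n. real (card (factors x n)) - real (card I + card J) * real n)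
    at_top sequentially"
  using recur
proof
  assume "\<forall>c\<in>{a, b}. \<forall>w\<in>L c. \<forall>P. \<exists>p\<ge>P. factor x p (length w) = w"
  then interpret right_recurrent_family x I J L a b
    using ab by unfold_locales auto
  show ?thesis by (rule complexity_growth_right)
next
  assume left: "\<forall>c\<in>{a, b}. \<forall>w\<in>L c. \<forall>P. \<exists>p\<le>P. factor x p (length w) = w"
  interpret R: language_family "\<lambda>k. x (- k)" I J "\<lambda>i. rev ` L i" by (rule reflect)
  interpret R: right_recurrent_family "\<lambda>k. x (- k)" I J "\<lambda>i. rev ` L i" a b
  proof
    show "a \<in> I" "b \<in> I" "a \<noteq> b" by (rule ab)+
    fix c w P assume "c \<in> {a, b}" "w \<in> rev ` L c"
    \<comment> \<open>An occurrence of \<open>rev w\<close> at \<open>p\<close> reflects to one of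
      \<open>w\<close> at \<open>1 - p - int (length w)\<close>; the bound on \<open>p\<close>
      places it at or beyond \<open>P\<close>.\<close>
    then obtain p where p: "p \<le> 1 - P - int (length w)" "factor x p (length w) = rev w"
      using left by (metis imageE length_rev rev_rev_ident)
    then show "\<exists>p\<ge>P. factor (\<lambda>k. x (- k)) p (length w) = w"
      by (intro exI[of _ "1 - p - int (length w)"]) (simp add: factor_reflect)
  qed
  show ?thesis
    using R.complexity_growth_right by (simp add: factors_reflect card_image)
qed

section \<open>Minimal subsystems\<close>

lemma topspace_full_shift [simp]: "topspace full_shift_topology = UNIV"
  by (simp add: full_shift_topology_def)

lemma openin_cylinder: "openin full_shift_topology {y. \<forall>k. \<bar>k\<bar> \<le> m \<longrightarrow> y k = z k}"
  (is "openin _ ?U")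
proof -
  define V where "V k = (if \<bar>k\<bar> \<le> m then {z k} else UNIV)" for k
  have "finite {k. V k \<noteq> UNIV}"
    by (rule finite_subset[of _ "{- m..m}"]) (auto simp: V_def split: if_splits)
  moreover have "?U = Pi\<^sub>E UNIV V"
    by (auto simp: V_def PiE_UNIV_domain Pi_def)
  ultimately show ?thesis
    unfolding full_shift_topology_def openin_product_topology_alt by auto
qed

text \<open>Centred cylinders form a neighbourhood base: a basic open set constrains finitely many
  coordinates, which fit into one window. Topology is thereby turned into agreement on
  windows.\<close>

lemma in_closure_of_full_shift:
  "y \<in> full_shift_topology closure_of S \<longleftrightarrow> (\<forall>m. \<exists>s\<in>S. \<forall>k. \<bar>k\<bar> \<le> m \<longrightarrow> s k = y k)"
proof
  assume y: "y \<in> full_shift_topology closure_of S"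
  show "\<forall>m. \<exists>s\<in>S. \<forall>k. \<bar>k\<bar> \<le> m \<longrightarrow> s k = y k"
  proof
    fix m
    show "\<exists>s\<in>S. \<forall>k. \<bar>k\<bar> \<le> m \<longrightarrow> s k = y k"
    proof -
      have "\<exists>s. s \<in> S \<and> s \<in> U" if "y \<in> U" "openin full_shift_topology U" for U
        using y that by (auto simp: in_closure_of)
      from this[OF _ openin_cylinder[of m y]] show ?thesis by auto
    qed
  qed
next
  assume approx: "\<forall>m. \<exists>s\<in>S. \<forall>k. \<bar>k\<bar> \<le> m \<longrightarrow> s k = y k"
  show "y \<in> full_shift_topology closure_of S"
    unfolding in_closure_of
  proof (intro conjI allI impI)
    fix U assume U: "y \<in> U \<and> openin full_shift_topology U"
    then have "\<exists>V. finite {k. V k \<noteq> UNIV} \<and> y \<in> Pi\<^sub>E UNIV V \<and> Pi\<^sub>E UNIV V \<subseteq> U"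
      unfolding full_shift_topology_def openin_product_topology_alt by simp
    then obtain V where V: "finite {k. V k \<noteq> UNIV}" "y \<in> Pi\<^sub>E UNIV V" "Pi\<^sub>E UNIV V \<subseteq> U"
      by blast
    \<comment> \<open>A radius covering all constrained coordinates; the inserted 0 handles the case
      that there are none.\<close>
    define m where "m = Max (insert 0 (abs ` {k. V k \<noteq> UNIV}))"
    have m: "\<bar>k\<bar> \<le> m" if "V k \<noteq> UNIV" for k
      unfolding m_def using V(1) that by (intro Max_ge) auto
    obtain s where s: "s \<in> S" "\<And>k. \<bar>k\<bar> \<le> m \<Longrightarrow> s k = y k" using approx by blast
    have "s k \<in> V k" for k
      using s(2)[of k] m[of k] V(2) by (cases "V k = UNIV") (auto simp: PiE_UNIV_domain Pi_def)
    then have "s \<in> U" using V(3) by (auto simp: PiE_UNIV_domain)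
    then show "\<exists>s. s \<in> S \<and> s \<in> U" using s by blast
  qed simp
qed

lemma in_closure_of_orbit:
  "y \<in> full_shift_topology closure_of (orbit x) \<longleftrightarrow>
    (\<forall>m. \<exists>n. \<forall>k. \<bar>k\<bar> \<le> m \<longrightarrow> x (k + n) = y k)"
proof -
  have "(\<exists>s\<in>orbit x. P s) \<longleftrightarrow> (\<exists>n. P (shift_pow n x))" for P
    by (auto simp: orbit_def)
  then show ?thesis by (simp add: in_closure_of_full_shift shift_pow_apply)
qed

lemma factor_of_orbit_closure:
  assumes "y \<in> full_shift_topology closure_of (orbit x)"
  shows "\<exists>p. factor x p n = factor y q n"
proof -
  \<comment> \<open>This radius covers the block of length \<open>n\<close> at \<open>q\<close>,
    wherever \<open>q\<close> lies.\<close>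
  obtain r where r: "\<And>k. \<bar>k\<bar> \<le> \<bar>q\<bar> + int n \<Longrightarrow> x (k + r) = y k"
    using assms unfolding in_closure_of_orbit by blast
  have "factor x (q + r) n = factor y q n"
    unfolding factor_eq_iff
  proof (intro allI impI)
    fix m assume "m < n"
    then have "\<bar>q + int m\<bar> \<le> \<bar>q\<bar> + int n" by linarith
    then show "x (q + r + int m) = y (q + int m)" using r[of "q + int m"] by (simp add: algebra_simps)
  qed
  then show ?thesis ..
qed

section \<open>Invariance, closedness and minimality\<close>

lemma subshift_shift_pow:
  assumes "subshift X" "y \<in> X"
  shows "shift_pow n y \<in> X"
proof -
  have im: "shift ` X = X" using assms by (simp add: subshift_def)
  have pos: "(shift ^^ m) y \<in> X" for m
    by (induction m) (use assms im in auto)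
  have inv: "inv shift (shift z) = z" for z :: "int \<Rightarrow> 'a"
    by (simp add: inv_shift shift_def)
  have "inv shift z \<in> X" if "z \<in> X" for z
    using that im inv by (metis imageE)
  then have neg: "(inv shift ^^ m) y \<in> X" for m
    by (induction m) (use assms in auto)
  show ?thesis using pos neg by (simp add: shift_pow_def)
qed

lemma subshift_closed:
  assumes "subshift X" "\<And>m. \<exists>s\<in>X. \<forall>k. \<bar>k\<bar> \<le> m \<longrightarrow> s k = y k"
  shows "y \<in> X"
proof -
  have "full_shift_topology closure_of X = X"
    using assms(1) by (simp add: subshift_def closure_of_closedin)
  then show ?thesis using assms(2) in_closure_of_full_shift[of y X] by auto
qed

text \<open>Both are the orbit closure of the common point \<open>y\<close>.\<close>

lemma minimal_subshift_eq:
  assumes "minimal_subshift M" "minimal_subshift M'" "y \<in> M" "y \<in> M'"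
  shows "M = M'"
  using assms unfolding minimal_subshift_def by metis

text \<open>A transitive point in \<open>M\<close> makes \<open>X\<close> equal to \<open>M\<close>,
  and a minimal subshift inside \<open>M\<close> shares a point with it. Several minimal subsystems
  therefore keep \<open>x\<close> outside all of them.\<close>

lemma transitive_point_in_minimal:
  assumes X: "X = full_shift_topology closure_of (orbit x)" and "subshift X"
    and M: "minimal_subshift M" "x \<in> M"
  shows "minimal_subsystems X \<subseteq> {M}"
proof
  fix M' assume M': "M' \<in> minimal_subsystems X"
  have "X = M" using X M by (auto simp: minimal_subshift_def)
  then have "M' \<subseteq> M" "minimal_subshift M'" using M' by (auto simp: minimal_subsystems_def)
  then show "M' \<in> {M}" using minimal_subshift_eq[OF _ M(1)] by (auto simp: minimal_subshift_def)
qed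

section \<open>Languages of subshifts\<close>

definition language :: "(int \<Rightarrow> 'a) set \<Rightarrow> 'a list set" where
  "language M = (\<Union>n. words M n)"

lemma words_eq: "words M n = (\<Union>y\<in>M. factors y n)"
  by (auto simp: words_def factors_def factor_def)

lemma language_iff: "w \<in> language M \<longleftrightarrow> (\<exists>y\<in>M. \<exists>p. w = factor y p (length w))"
  by (force simp: language_def words_eq factors_def)

text \<open>Shifts of \<open>x\<close> approximate each point of \<open>X\<close> on finite windows.
  The complexity of \<open>X\<close> thus becomes the factor count of one sequence.\<close>

lemma words_orbit_closure:
  assumes "X = full_shift_topology closure_of (orbit x)"
  shows "words X n = factors x n"
proof -
  have "x \<in> X" unfolding assms in_closure_of_orbit by (metis add.right_neutral)
  moreover have "factors y n \<subseteq> factors x n" if "y \<in> X" for y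
    using factor_of_orbit_closure that unfolding assms factors_def by (metis image_subsetI rangeI)
  ultimately show ?thesis unfolding words_eq by blast
qed

lemma language_factorial:
  assumes "u @ v @ w \<in> language M"
  shows "v \<in> language M"
proof -
  obtain y p where y: "y \<in> M" "u @ v @ w = factor y p (length u + (length v + length w))"
    using assms by (auto simp: language_iff)
  then have "v = factor y (p + int (length u)) (length v)"
    by (simp add: factor_append)
  then show ?thesis using y unfolding language_iff by blast
qed

lemma language_extend:
  assumes "w \<in> language M"
  shows "\<exists>a. a # w \<in> language M" "\<exists>a. w @ [a] \<in> language M"
proof -
  obtain y p where y: "y \<in> M" "w = factor y p (length w)"
    using assms by (auto simp: language_iff)
  have "y (p - 1) # w = factor y (p - 1) (Suc (length w))"
    using y(2) by (simp add: factor_Suc_Cons)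
  then show "\<exists>a. a # w \<in> language M" using y(1) unfolding language_iff by (metis length_Cons)
  have "w @ [y (p + int (length w))] = factor y p (Suc (length w))"
    using y(2) by (simp add: factor_Suc)
  then show "\<exists>a. w @ [a] \<in> language M"
    using y(1) unfolding language_iff by (metis length_append_singleton)
qed

lemma level_language: "{w \<in> language M. length w = n} = words M n"
  by (auto simp: language_def words_eq factors_def)

lemma finite_words: "finite (words (M :: (int \<Rightarrow> 'a::finite) set) n)"
  unfolding level_language[symmetric] by (rule finite_lists_of_length)

text \<open>Finitely many distinct points are told apart by a common finite window.\<close>

lemma infinite_imp_unbounded_words:
  fixes M :: "(int \<Rightarrow> 'a::finite) set"
  assumes "infinite M"
  shows "\<exists>n. K \<le> card (words M n)"
proof -
  obtain A where A: "finite A" "card A = K" "A \<subseteq> M"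
    using infinite_arbitrarily_large[OF assms] by blast
  have "\<forall>z\<in>A \<times> A. \<exists>k. fst z \<noteq> snd z \<longrightarrow> fst z k \<noteq> snd z k" by (auto simp: fun_eq_iff)
  then obtain f where f: "\<forall>z\<in>A \<times> A. fst z \<noteq> snd z \<longrightarrow> fst z (f z) \<noteq> snd z (f z)"
    by (rule bchoice[THEN exE])
  \<comment> \<open>A radius containing all the coordinates chosen to tell points of
    \<open>A\<close> apart; 0 is the default when \<open>A\<close> is empty.\<close>
  define m where "m = nat (Max (insert 0 (abs ` f ` (A \<times> A))))"
  have m: "\<bar>f z\<bar> \<le> int m" if "z \<in> A \<times> A" for z
  proof -
    have "\<bar>f z\<bar> \<le> Max (insert 0 (abs ` f ` (A \<times> A)))" using A that by (intro Max_ge) auto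
    then show ?thesis unfolding m_def by linarith
  qed
  have "inj_on (\<lambda>y. factor y (- int m) (2 * m + 1)) A"
  proof (rule inj_onI, rule ccontr)
    fix y z assume h: "y \<in> A" "z \<in> A" "y \<noteq> z"
      "factor y (- int m) (2 * m + 1) = factor z (- int m) (2 * m + 1)"
    define k where "k = f (y, z)"
    have k: "\<bar>k\<bar> \<le> int m" "y k \<noteq> z k" using m[of "(y, z)"] bspec[OF f, of "(y, z)"] h(1-3) by (simp_all add: k_def)
    have "nat (k + int m) < 2 * m + 1" using k(1) by linarith
    then have "y (- int m + int (nat (k + int m))) = z (- int m + int (nat (k + int m)))"
      using h(4) unfolding factor_eq_iff by blast
    moreover have "0 \<le> k + int m" using k(1) by linarith
    ultimately show False using k(2) by simp
  qed
  moreover have "(\<lambda>y. factor y (- int m) (2 * m + 1)) ` A \<subseteq> words M (2 * m + 1)"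
    using A by (auto simp: words_eq factors_def)
  ultimately have "card A \<le> card (words M (2 * m + 1))"
    using card_inj_on_le finite_words by blast
  then show ?thesis using A by blast
qed

section \<open>Separation of disjoint subshifts by compactness\<close>

lemma compact_space_full_shift: "compact_space (full_shift_topology :: (int \<Rightarrow> 'a::finite) topology)"
  unfolding full_shift_topology_def
  by (simp add: compact_space_product_topology compact_space_discrete_topology)

text \<open>Around each point of \<open>M\<close> some cylinder misses \<open>M'\<close>, and
  finitely many of these cover \<open>M\<close>. A common word as long as the largest of their
  windows would put points of both subshifts into one of these cylinders.\<close>

lemma disjoint_subshifts_separated:
  fixes M M' :: "(int \<Rightarrow> 'a::finite) set"
  assumes M: "subshift M" and M': "subshift M'" and disj: "M \<inter> M' = {}"
  shows "\<exists>n. \<forall>w \<in> language M \<inter> language M'. length w < n"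
proof -
  have "\<exists>m. \<forall>s\<in>M'. \<not> (\<forall>k. \<bar>k\<bar> \<le> m \<longrightarrow> s k = y k)" if "y \<in> M" for y
    using subshift_closed[OF M', of y] disj that by blast
  then obtain f where f: "\<And>y s. y \<in> M \<Longrightarrow> s \<in> M' \<Longrightarrow> \<exists>k. \<bar>k\<bar> \<le> f y \<and> s k \<noteq> y k"
    by metis
  define U where "U y = {z. \<forall>k. \<bar>k\<bar> \<le> f y \<longrightarrow> z k = y k}" for y
  have "compactin full_shift_topology M"
    using closedin_compact_space[OF compact_space_full_shift] M by (auto simp: subshift_def)
  moreover have "\<And>V. V \<in> U ` M \<Longrightarrow> openin full_shift_topology V"
    by (auto simp: U_def openin_cylinder)
  moreover have "M \<subseteq> \<Union>(U ` M)" by (auto simp: U_def)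
  ultimately obtain \<F> where \<F>: "finite \<F>" "\<F> \<subseteq> U ` M" "M \<subseteq> \<Union>\<F>"
    unfolding compactin_def by metis
  then obtain A where A: "finite A" "A \<subseteq> M" "\<F> = U ` A"
    by (meson finite_subset_image)
  define m where "m = nat (Max (insert 0 (f ` A)))"
  have m: "f y \<le> int m" if "y \<in> A" for y
  proof -
    have "f y \<le> Max (insert 0 (f ` A))" using A that by (intro Max_ge) auto
    then show ?thesis by (simp add: m_def)
  qed
  have "length w < 2 * m + 1" if w: "w \<in> language M" "w \<in> language M'" for w
  proof (rule ccontr)
    assume long: "\<not> ?thesis"
    obtain y p where y: "y \<in> M" "w = factor y p (length w)" using w(1) by (auto simp: language_iff)
    obtain s q where s: "s \<in> M'" "w = factor s q (length w)" using w(2) by (auto simp: language_iff)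
    \<comment> \<open>Both points are shifted so that the common word starts at
      \<open>- int m\<close>; having length at least \<open>2 * m + 1\<close>, it covers the whole
      window.\<close>
    define y' where "y' = shift_pow (p + int m) y"
    define s' where "s' = shift_pow (q + int m) s"
    have y': "y' \<in> M" and s': "s' \<in> M'"
      using subshift_shift_pow M M' y s by (auto simp: y'_def s'_def)
    have agree: "y' k = s' k" if "\<bar>k\<bar> \<le> int m" for k
    proof -
      have "factor y p (length w) = factor s q (length w)" using y(2) s(2) by simp
      moreover have "nat (k + int m) < length w" using that long by linarith
      ultimately have "y (p + int (nat (k + int m))) = s (q + int (nat (k + int m)))"
        unfolding factor_eq_iff by blast
      moreover have "0 \<le> k + int m" using that by linarith
      ultimately show ?thesis by (simp add: y'_def s'_def shift_pow_apply algebra_simps)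
    qed
    obtain z where z: "z \<in> A" "y' \<in> U z" using \<F>(3) A(3) y' by blast
    obtain k where k: "\<bar>k\<bar> \<le> f z" "s' k \<noteq> z k" using f[of z s'] z A s' by blast
    then have "y' k = z k" using z(2) by (auto simp: U_def)
    then show False using k agree[of k] m[OF z(1)] by simp
  qed
  then show ?thesis by blast
qed

text \<open>If the windows of a point of \<open>M\<close> occurred in \<open>x\<close> only at a bounded set of positions, one
  position would serve all windows and the orbit of \<open>x\<close> would meet \<open>M\<close>.\<close>

lemma minimal_recurs_right_or_left:
  assumes X: "X = full_shift_topology closure_of (orbit x)"
    and M: "M \<in> minimal_subsystems X" and x: "x \<notin> M"
  shows "(\<forall>w\<in>language M. \<forall>P. \<exists>p\<ge>P. factor x p (length w) = w) \<or>
    (\<forall>w\<in>language M. \<forall>P. \<exists>p\<le>P. factor x p (length w) = w)"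
proof -
  have min: "minimal_subshift M" and MX: "M \<subseteq> X" using M by (auto simp: minimal_subsystems_def)
  then have sub: "subshift M" by (simp add: minimal_subshift_def)
  obtain y where y: "y \<in> M" using min by (auto simp: minimal_subshift_def)
  \<comment> \<open>The central window of \<open>y\<close> of radius \<open>m\<close> occurs in
    \<open>x\<close> centred at \<open>n\<close>.\<close>
  define matches where "matches m n \<longleftrightarrow> (\<forall>k. \<bar>k\<bar> \<le> m \<longrightarrow> x (k + n) = y k)" for m n
  have matches_mono: "matches m n" if "matches m' n" "m \<le> m'" for m m' n
    using that unfolding matches_def by auto
  have ex: "\<exists>n. matches m n" for m
  proof -
    have "y \<in> full_shift_topology closure_of (orbit x)" using y MX X by blast
    then show ?thesis unfolding in_closure_of_orbit matches_def by blast
  qed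
  \<comment> \<open>By minimality \<open>w\<close> occurs in \<open>y\<close> at some offset
    \<open>l\<close>, so every sufficiently wide match carries \<open>w\<close> at that
    offset.\<close>
  have window: "\<exists>m l. \<forall>n. matches m n \<longrightarrow> factor x (n + l) (length w) = w" if "w \<in> language M" for w
  proof -
    obtain z q where z: "z \<in> M" "w = factor z q (length w)"
      using \<open>w \<in> language M\<close> by (auto simp: language_iff)
    have "z \<in> full_shift_topology closure_of (orbit y)"
      using min y z(1) by (auto simp: minimal_subshift_def)
    then obtain l where l: "factor y l (length w) = w" using factor_of_orbit_closure z(2) by metis
    have "factor x (n + l) (length w) = w" if "matches (\<bar>l\<bar> + int (length w)) n" for n
    proof -
      have "factor x (n + l) (length w) = factor y l (length w)"
        unfolding factor_eq_iff
      proof (intro allI impI)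
        fix k assume "k < length w"
        then have "\<bar>l + int k\<bar> \<le> \<bar>l\<bar> + int (length w)" by linarith
        then have "x (l + int k + n) = y (l + int k)"
          using that unfolding matches_def by blast
        then show "x (n + l + int k) = y (l + int k)"
          by (simp add: algebra_simps)
      qed
      then show ?thesis using l by simp
    qed
    then show ?thesis by blast
  qed
  have "(\<forall>m P. \<exists>n\<ge>P. matches m n) \<or> (\<forall>m P. \<exists>n\<le>P. matches m n)"
  proof (rule ccontr)
    assume "\<not> ?thesis"
    then obtain m1 P1 m2 P2 where h: "\<And>n. n \<ge> P1 \<Longrightarrow> \<not> matches m1 n" "\<And>n. n \<le> P2 \<Longrightarrow> \<not> matches m2 n"
      by blast
    define m where "m = max 0 (max m1 m2)"
    have bounded: "n \<in> {P2..P1}" if "matches (m + int l) n" for n l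
    proof -
      have "matches m1 n" "matches m2 n"
        by (rule matches_mono[OF that], simp add: m_def)+
      then show ?thesis using h[of n] by force
    qed
    \<comment> \<open>Wide matches are confined to finitely many positions. If each position failed
      at some radius, the largest of these radii would admit no match at all.\<close>
    have "\<exists>n. \<forall>l. matches (m + int l) n"
    proof (rule ccontr)
      assume "\<not> ?thesis"
      then obtain g where g: "\<And>n. \<not> matches (m + int (g n)) n" by metis
      define G where "G = Max (insert 0 (g ` {P2..P1}))"
      obtain n where n: "matches (m + int G) n" using ex by blast
      have "g n \<le> G" unfolding G_def using bounded[OF n] by (intro Max_ge) auto
      then show False using g[of n] matches_mono[OF n] by simp
    qed
    then obtain n where n: "\<And>l. matches (m + int l) n" by blast
    \<comment> \<open>Matching at every radius makes \<open>x\<close> a shift of \<open>y\<close>,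
      so that \<open>x\<close> would lie in \<open>M\<close>.\<close>
    have "x (k + n) = y k" for k
    proof -
      have "\<bar>k\<bar> \<le> m + int (nat \<bar>k\<bar>)" by (simp add: m_def)
      then show ?thesis using n[of "nat \<bar>k\<bar>"] unfolding matches_def by blast
    qed
    from this[of "k - n" for k] have "x = shift_pow (- n) y"
      by (simp add: fun_eq_iff shift_pow_apply)
    then show False using subshift_shift_pow[OF sub y] x by metis
  qed
  then show ?thesis
  proof
    assume right: "\<forall>m P. \<exists>n\<ge>P. matches m n"
    have "\<exists>p\<ge>P. factor x p (length w) = w" if "w \<in> language M" for w P
    proof -
      obtain m l where ml: "\<And>n. matches m n \<Longrightarrow> factor x (n + l) (length w) = w"
        using window[OF \<open>w \<in> language M\<close>] by blast
      obtain n where "n \<ge> P - l" "matches m n" using right by blast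
      then show ?thesis using ml by (intro exI[of _ "n + l"]) auto
    qed
    then show ?thesis by blast
  next
    assume left: "\<forall>m P. \<exists>n\<le>P. matches m n"
    have "\<exists>p\<le>P. factor x p (length w) = w" if "w \<in> language M" for w P
    proof -
      obtain m l where ml: "\<And>n. matches m n \<Longrightarrow> factor x (n + l) (length w) = w"
        using window[OF \<open>w \<in> language M\<close>] by blast
      obtain n where "n \<le> P - l" "matches m n" using left by blast
      then show ?thesis using ml by (intro exI[of _ "n + l"]) auto
    qed
    then show ?thesis by blast
  qed
qed

text \<open>Distinct minimal subsystems are disjoint, which compactness turns into
  \<open>separated\<close>; an infinite one has unboundedly many words of some length, which gives
  \<open>unbounded\<close>.\<close>

lemma language_family_minimal_subsystems:
  fixes X :: "(int \<Rightarrow> 'a::finite) set"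
  assumes X: "X = full_shift_topology closure_of (orbit x)" and fin: "finite (minimal_subsystems X)"
  shows "language_family x (minimal_subsystems X) {M \<in> minimal_subsystems X. infinite M} language"
proof
  show "finite (minimal_subsystems X)" by (rule fin)
  show "{M \<in> minimal_subsystems X. infinite M} \<subseteq> minimal_subsystems X" by blast
  fix M assume M: "M \<in> minimal_subsystems X"
  then have min: "minimal_subshift M" and MX: "M \<subseteq> X" by (auto simp: minimal_subsystems_def)
  show "language M \<noteq> {}"
    using min by (auto simp: minimal_subshift_def language_def words_eq factors_def)
  show "v \<in> language M" if "u @ v @ w \<in> language M" for u v w
    using that by (rule language_factorial)
  show "\<exists>a. a # w \<in> language M" "\<exists>a. w @ [a] \<in> language M" if "w \<in> language M" for w
    using language_extend[OF that] by auto
  show "\<exists>p. factor x p (length w) = w" if "w \<in> language M" for w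
    using that factor_of_orbit_closure MX X by (metis language_iff subsetD)
  show "\<exists>n. \<forall>w \<in> language M \<inter> language M'. length w < n"
    if "M' \<in> minimal_subsystems X" "M \<noteq> M'" for M'
  proof (rule disjoint_subshifts_separated)
    have min': "minimal_subshift M'" using that by (auto simp: minimal_subsystems_def)
    show "subshift M" "subshift M'" using min min' by (auto simp: minimal_subshift_def)
    show "M \<inter> M' = {}" using minimal_subshift_eq[OF min min'] that by blast
  qed
next
  fix M K assume "M \<in> {M \<in> minimal_subsystems X. infinite M}"
  then show "\<exists>n. K \<le> card {w \<in> language M. length w = n}"
    unfolding level_language using infinite_imp_unbounded_words by blast
qed

theorem theorem1p3:
  fixes X :: "(int \<Rightarrow> 'a::finite) set" and i j :: nat
  assumes "transitive_subshift X"
    and "j \<ge> 3" and "i \<le> j"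
    and "finite (minimal_subsystems X)" and "card (minimal_subsystems X) = j"
    and "card {M \<in> minimal_subsystems X. infinite M} = i"
  shows "liminf (\<lambda>n. ereal (real (complexity X n) - real (j + i) * real n)) = \<infinity>"
proof -
  obtain x where x: "X = full_shift_topology closure_of (orbit x)" and sub: "subshift X"
    using assms(1) by (auto simp: transitive_subshift_def)
  interpret language_family x "minimal_subsystems X" "{M \<in> minimal_subsystems X. infinite M}" language
    by (rule language_family_minimal_subsystems[OF x assms(4)])
  have x_notin: "x \<notin> M" if "M \<in> minimal_subsystems X" for M
  proof
    assume "x \<in> M"
    then have "minimal_subsystems X \<subseteq> {M}"
      using transitive_point_in_minimal[OF x sub] that by (simp add: minimal_subsystems_def)
    then have "card (minimal_subsystems X) \<le> card {M}" by (intro card_mono) simp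
    then have "card (minimal_subsystems X) \<le> 1" by simp
    then show False using assms(2,5) by simp
  qed
  define right where
    "right M \<longleftrightarrow> (\<forall>w\<in>language M. \<forall>P. \<exists>p\<ge>P. factor x p (length w) = w)" for M
  define left where
    "left M \<longleftrightarrow> (\<forall>w\<in>language M. \<forall>P. \<exists>p\<le>P. factor x p (length w) = w)" for M
  have rl: "right M \<or> left M" if "M \<in> minimal_subsystems X" for M
    using minimal_recurs_right_or_left[OF x that x_notin[OF that]] by (simp add: right_def left_def)
  \<comment> \<open>Pigeonhole: three subsystems, each recurring to the right or to the left,
    include two that recur on the same side.\<close>
  obtain T where T: "T \<subseteq> minimal_subsystems X" "card T = 3"
    using obtain_subset_with_card_n[of 3 "minimal_subsystems X"] assms(2,5) by metis
  then obtain A B C where ABC: "A \<noteq> B" "B \<noteq> C" "A \<noteq> C" "{A, B, C} \<subseteq> minimal_subsystems X"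
    by (auto simp: card_3_iff)
  then obtain M M' where MM': "M \<in> minimal_subsystems X" "M' \<in> minimal_subsystems X" "M \<noteq> M'"
      "right M \<and> right M' \<or> left M \<and> left M'"
    using rl by (metis insert_subset)
  have "filterlim (\<lambda>n. real (card (factors x n)) - real (j + i) * real n) at_top sequentially"
    using complexity_growth[OF MM'(1-3)] MM'(4) assms(5,6) unfolding right_def left_def by auto
  then have "(\<lambda>n. ereal (real (complexity X n) - real (j + i) * real n)) \<longlonglongrightarrow> \<infinity>"
    unfolding tendsto_PInfty_eq_at_top complexity_def words_orbit_closure[OF x] .
  then show ?thesis by (rule lim_imp_Liminf[OF sequentially_bot])
qed

end
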